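(* Let $a=-1$ and let $(R_n)_{n\geq 1}$ be the sequence of polynomials defined by $R_1(x)=x$ and, for $n\geq 1$, $R_{n+1}(x)=xR_n(x)-\frac{a}{n}(1-x^2)R_n'(x)$. Let $T(n,k)$, for $n\geq 1$ and $0\leq k\leq\lfloor\frac{n-1}{2}\rfloor$, be the integers defined by $T(1,0)=1$ and, for $n\geq 2$, $T(n,k)=(k+1)T(n-1,k)+(2n-4k)T(n-1,k-1)$, and let $U_n(y)=\sum_{k=0}^{\lfloor\frac{n-1}{2}\rfloor}T(n,k)y^k$ for $n\geq 1$. Then for all $n\geq 2$, $$R_n(x)=\frac{(2x)^{n-2}}{(n-1)!}\,U_{n-1}\left(\frac{1}{4x^2}\right).$$
   Context: In the recurrence for $T(n,k)$, terms $T(m,j)$ with indices outside the range $0\leq j\leq\lfloor\frac{m-1}{2}\rfloor$ are taken to be $0$. The stated identity is an identity of rational functions in $x$ (equivalently, it holds for all $x\neq 0$). *)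

theory Defs
  imports "HOL-Computational_Algebra.Polynomial"
begin

(* The sequence starts at index 1; the value at index 0 is a dummy. *)
primrec R_poly :: "'a::field_char_0 \<Rightarrow> nat \<Rightarrow> 'a poly" where
  "R_poly a 0 = 0"
| "R_poly a (Suc n) =
     (if n = 0 then [:0, 1:]
      else [:0, 1:] * R_poly a n
             - smult (a / of_nat n) ([:1, 0, -1:] * pderiv (R_poly a n)))"

(* The outer conditional makes T n k vanish whenever k > (n - 1) div 2, and the
   inner one handles T (n - 1) (-1) = 0, since k - 1 truncates on nat. The value
   at n = 0 is a dummy. *)
primrec T_coeff :: "nat \<Rightarrow> nat \<Rightarrow> int" where
  "T_coeff 0 k = 0"
| "T_coeff (Suc m) k =
     (if k \<le> m div 2 then
        (if m = 0 then 1
         else (int k + 1) * T_coeff m k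
                + (2 * int (Suc m) - 4 * int k) * (if k = 0 then 0 else T_coeff m (k - 1)))
      else 0)"

definition U_poly :: "nat \<Rightarrow> 'a::field_char_0 \<Rightarrow> 'a" where
  "U_poly n y = (\<Sum>k = 0..(n - 1) div 2. of_int (T_coeff n k) * y ^ k)"

end

theory Submission
  imports Defs
begin

text \<open>
  Put \<open>y = 2x\<close> and write \<open>m\<close> for \<open>n - 1\<close>. The claim becomes the polynomial identity
  \<open>m! R\<^sub>m\<^sub>+\<^sub>1 = (\<Sum>k. T(m,k) y ^ (m-1-2k))\<close>, proved by induction on \<open>m\<close>. Applying
  \<open>P \<mapsto> (m+1) x P + (1 - x\<^sup>2) P'\<close> to \<open>y ^ d\<close> with \<open>d = m-1-2k\<close> gives
  \<open>(k+1) y ^ (d+1) + 2 d y ^ (d-1)\<close>, and these are exactly the two contributions of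
  \<open>T(m,k)\<close> to the row \<open>m+1\<close>.
\<close>

lemma T_coeff_eq_0: "m < 2 * k + 1 \<Longrightarrow> T_coeff m k = 0"
  by (cases m) auto

lemma T_coeff_Suc_0: "0 < m \<Longrightarrow> T_coeff (Suc m) 0 = T_coeff m 0"
  by simp

text \<open>The bounds on \<open>k+1\<close> can be dropped: just outside the range the factor
  \<open>2(m+1) - 4(k+1)\<close> vanishes.\<close>

lemma T_coeff_Suc_Suc:
  assumes "0 < m"
  shows "T_coeff (Suc m) (Suc k) =
    (int k + 2) * T_coeff m (Suc k) + (2 * int m - 2 - 4 * int k) * T_coeff m k"
proof (cases "Suc k \<le> m div 2")
  case True
  with assms show ?thesis by (simp add: algebra_simps)
next
  case False
  then have "m < 2 * Suc k" by arith
  then have "T_coeff m (Suc k) = 0" by (intro T_coeff_eq_0) simp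
  moreover have "(2 * int m - 2 - 4 * int k) * T_coeff m k = 0"
  proof (cases "m = 2 * k + 1")
    case False
    with \<open>m < 2 * Suc k\<close> have "T_coeff m k = 0" by (intro T_coeff_eq_0) simp
    then show ?thesis by simp
  qed simp
  ultimately show ?thesis using False by simp
qed

text \<open>The exponent truncates to \<open>0\<close> only for \<open>2k > m - 1\<close>, where the coefficient is \<open>0\<close>.\<close>

definition row_poly :: "nat \<Rightarrow> 'a::field_char_0 poly" where
  "row_poly m = (\<Sum>k\<le>m. smult (of_int (T_coeff m k)) ([:0, 2:] ^ (m - 1 - 2 * k)))"

lemma poly_row_poly:
  "poly (row_poly m) x = (\<Sum>k\<le>m. of_int (T_coeff m k) * (2 * x) ^ (m - 1 - 2 * k))"
  by (simp add: row_poly_def poly_sum mult.commute)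

lemma poly_pderiv_row_poly:
  "poly (pderiv (row_poly m)) x =
    (\<Sum>k\<le>m. of_int (T_coeff m k) * (2 * of_nat (m - 1 - 2 * k) * (2 * x) ^ (m - 1 - 2 * k - 1)))"
  by (simp add: row_poly_def poly_sum higher_pderiv_sum[of 1, simplified] pderiv_smult
      pderiv_power pderiv_pCons mult_ac)

text \<open>The recurrence of \<open>T_coeff\<close> read as a differential recurrence; up to the
  factor \<open>fact (Suc m)\<close> it is the one defining \<open>R_poly\<close> at
  \<open>a = -1\<close>.\<close>

lemma row_poly_Suc:
  fixes x :: "'a::field_char_0"
  assumes m: "0 < m"
  shows "poly (row_poly (Suc m)) x =
    of_nat (Suc m) * x * poly (row_poly m) x + (1 - x\<^sup>2) * poly (pderiv (row_poly m)) x"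
proof -
  define y where "y = 2 * x"
  define t :: "nat \<Rightarrow> 'a" where "t k = of_int (T_coeff m k)" for k
  have t_0: "t k = 0" if "m < 2 * k + 1" for k
    using that by (simp add: t_def T_coeff_eq_0)
  \<comment> \<open>With \<open>d = m - 1 - 2 * k\<close>, the \<open>y ^ (d + 1)\<close> terms
    collect the factor \<open>(m + 1 - d) / 2 = k + 1\<close>, as \<open>x = y / 2\<close>.\<close>
  have step: "of_nat (Suc m) * x * (t k * y ^ (m - 1 - 2 * k)) +
      (1 - x\<^sup>2) * (t k * (2 * of_nat (m - 1 - 2 * k) * y ^ (m - 1 - 2 * k - 1))) =
      of_nat (Suc k) * t k * y ^ (m - 2 * k) +
      (2 * of_nat m - 2 - 4 * of_nat k) * t k * y ^ (m - 2 * Suc k)" for k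
  proof (cases "m < 2 * k + 1")
    case True
    then show ?thesis by (simp add: t_0)
  next
    case False
    then obtain d where d: "m = 2 * k + 1 + d"
      using le_iff_add[of "2 * k + 1" m] by auto
    show ?thesis
    \<comment> \<open>For \<open>d = 0\<close> the exponent \<open>d - 1\<close> truncates, but the
      factor \<open>d\<close> kills that term.\<close>
    proof (cases d)
      case 0
      then show ?thesis by (simp add: d y_def algebra_simps)
    next
      case (Suc e)
      then show ?thesis by (simp add: d y_def algebra_simps power2_eq_square)
    qed
  qed
  have "poly (row_poly (Suc m)) x =
      (\<Sum>k\<le>Suc m. of_int (T_coeff (Suc m) k) * y ^ (m - 2 * k))"
    by (simp only: poly_row_poly y_def diff_Suc_1)
  also have "\<dots> = t 0 * y ^ m +
      (\<Sum>k\<le>m. of_int (T_coeff (Suc m) (Suc k)) * y ^ (m - 2 * Suc k))"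
    using m by (subst sum.atMost_Suc_shift)
      (simp del: T_coeff.simps add: T_coeff_Suc_0 t_def)
  also have "\<dots> = t 0 * y ^ m + (\<Sum>k\<le>m. of_nat (Suc (Suc k)) * t (Suc k) * y ^ (m - 2 * Suc k)) +
      (\<Sum>k\<le>m. (2 * of_nat m - 2 - 4 * of_nat k) * t k * y ^ (m - 2 * Suc k))"
    unfolding add.assoc sum.distrib[symmetric] T_coeff_Suc_Suc[OF m] t_def
    by (simp add: algebra_simps del: T_coeff.simps)
  \<comment> \<open>The split-off term returns as index 0, where \<open>of_nat (Suc k)\<close> is
    1.\<close>
  also have "t 0 * y ^ m + (\<Sum>k\<le>m. of_nat (Suc (Suc k)) * t (Suc k) * y ^ (m - 2 * Suc k)) =
      (\<Sum>k\<le>Suc m. of_nat (Suc k) * t k * y ^ (m - 2 * k))"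
    by (subst sum.atMost_Suc_shift) simp
  also have "\<dots> = (\<Sum>k\<le>m. of_nat (Suc k) * t k * y ^ (m - 2 * k))"
    by (simp add: t_0)
  finally show ?thesis
    unfolding poly_row_poly poly_pderiv_row_poly y_def[symmetric] t_def[symmetric]
      sum_distrib_left sum.distrib[symmetric] step .
qed

lemma R_poly_eq_row_poly:
  "0 < m \<Longrightarrow> smult (fact m) (R_poly (- 1) (Suc m)) = (row_poly m :: 'a::field_char_0 poly)"
proof (induction m rule: nat_induct_non_zero)
  case 1
  show ?case
    \<comment> \<open>Both sides are 1, since
      \<open>x\<^sup>2 + (1 - x\<^sup>2) = 1\<close>.\<close>
    by (simp add: row_poly_def pderiv_pCons)
next
  case (Suc m)
  show ?case
  proof (rule poly_eq_poly_eq_iff[THEN iffD1, OF ext])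
    fix x :: 'a
    let ?R = "R_poly (- 1) (Suc m) :: 'a poly"
    have "poly (smult (fact (Suc m)) (R_poly (- 1) (Suc (Suc m)))) x =
        fact (Suc m) * (x * poly ?R x + (1 - x\<^sup>2) * poly (pderiv ?R) x / of_nat (Suc m))"
      by (simp del: of_nat_Suc fact_Suc R_poly.simps(2)
          add: R_poly.simps(2)[of _ "Suc m"] power2_eq_square algebra_simps
            add_divide_distrib diff_divide_distrib)
    \<comment> \<open>\<open>fact (Suc m) / of_nat (Suc m) = fact m\<close> clears the
      denominator.\<close>
    also have "\<dots> = of_nat (Suc m) * x * (fact m * poly ?R x) +
        (1 - x\<^sup>2) * (fact m * poly (pderiv ?R) x)"
      by (simp del: of_nat_Suc R_poly.simps add: field_simps)
    also have "\<dots> = poly (row_poly (Suc m)) x"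
      using Suc by (simp only: row_poly_Suc Suc.IH[symmetric] poly_smult pderiv_smult)
    finally show "poly (smult (fact (Suc m)) (R_poly (- 1) (Suc (Suc m)))) x =
        poly (row_poly (Suc m)) x" .
  qed
qed

theorem proposition8:
  fixes x :: "'a::field_char_0" and n :: nat
  assumes "n \<ge> 2" and "x \<noteq> 0"
  shows "poly (R_poly (- 1) n) x
    = (2 * x) ^ (n - 2) / fact (n - 1) * U_poly (n - 1) (1 / (4 * x\<^sup>2))"
proof -
  define m where "m = n - 1"
  with assms have m: "0 < m" "n = Suc m" by auto
  have "fact m * poly (R_poly (- 1) n) x = poly (row_poly m) x"
    by (simp only: m(2) R_poly_eq_row_poly[OF m(1), symmetric] poly_smult)
  also have "\<dots> = (\<Sum>k = 0..(m - 1) div 2. of_int (T_coeff m k) * (2 * x) ^ (m - 1 - 2 * k))"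
    unfolding poly_row_poly
    by (rule sum.mono_neutral_right) (use m in \<open>auto simp: T_coeff_eq_0\<close>)
  also have "\<dots> = (2 * x) ^ (m - 1) * U_poly m (1 / (4 * x\<^sup>2))"
    unfolding U_poly_def sum_distrib_left
  proof (rule sum.cong)
    fix k assume "k \<in> {0..(m - 1) div 2}"
    then have "2 * k \<le> m - 1" by auto
    \<comment> \<open>No truncation occurs on this range, so the power splits as a quotient.\<close>
    then have "(2 * x) ^ (m - 1 - 2 * k) = (2 * x) ^ (m - 1) / (2 * x) ^ (2 * k)"
      using assms(2) by (intro power_diff) auto
    also have "(2 * x) ^ (2 * k) = (4 * x\<^sup>2) ^ k"
      by (simp add: power_mult power2_eq_square)
    finally have "(2 * x) ^ (m - 1 - 2 * k) = (2 * x) ^ (m - 1) / (4 * x\<^sup>2) ^ k" .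
    then show "of_int (T_coeff m k) * (2 * x) ^ (m - 1 - 2 * k) =
        (2 * x) ^ (m - 1) * (of_int (T_coeff m k) * (1 / (4 * x\<^sup>2)) ^ k)"
      by (simp add: power_divide)
  qed simp
  finally show ?thesis
    using m by (simp add: field_simps)
qed

end
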